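(* Let $\mathbb{P}$ be the polyhedron of feasible points of the STT LP for a tree topology $U$, and let $P\in\mathbb{P}$ be an integer point. If $P$ is induced by some STT $T$, then $P$ is a vertex on the lower envelope of $\mathbb{P}$. Moreover, if the projection $P_D$ of $P$ to the $D$ coordinates is a vertex on the lower envelope of the projection $\mathbb{P}_D$ of $\mathbb{P}$ to the $D$ coordinates, then $P$ is induced by some STT.
   Context: For a tree $U$ and distinct nodes $i,j$, $(i\leftrightsquigarrow j)$ denotes the nodes strictly between $i$ and $j$ on the $U$-path. An STT $T$ over $U$: pick a node $r$ as root; its subtrees are STTs built recursively over the components of $U\setminus\{r\}$. The STT LP for $U$ has variables $D_i$, $X_{ij}$ ($i\ne j$), $Z_{kij}=Z_{kji}$ ($k\in(i\leftrightsquigarrow j)$); constraints $X,Z\ge0$; $X_{ij}+X_{ji}+\sum_{k\in(i\leftrightsquigarrow j)}Z_{kij}\ge1$; $Z_{kij}\le X_{ki}$, $Z_{kij}\le X_{kj}$; $D_i\ge\sum_{j\ne i}X_{ji}$; objectives are of the form minimize $\sum_i w_iD_i$. The point induced by STT $T$ has $X_{ij}=1$ iff $i$ is a proper ancestor of $j$ in $T$, $Z_{kij}=1$ iff $k$ is the lowest common ancestor of $i$ and $j$ in $T$, other $X,Z$ zero, and $D_i=\sum_{j\ne i}X_{ji}$. A vertex of $\mathbb{P}$ (resp. $\mathbb{P}_D$) is on the lower envelope if there is a weight vector $w\in\mathbb{R}^n$ with nonnegative coordinates such that it is the unique minimizer of $\sum_i w_iD_i$ over $\mathbb{P}$ (resp.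 $\mathbb{P}_D$). *)

theory Defs
  imports "HOL-Analysis.Analysis" "HOL-Library.FSet"
begin

text \<open>The node set of the tree topology is all of a finite type \<^typ>\<open>'v\<close>; a graph is its adjacency
  relation.\<close>

definition simple_graph :: "('v \<Rightarrow> 'v \<Rightarrow> bool) \<Rightarrow> bool" where
  "simple_graph E \<longleftrightarrow> symp E \<and> irreflp E"

definition simple_path :: "('v \<Rightarrow> 'v \<Rightarrow> bool) \<Rightarrow> 'v \<Rightarrow> 'v list \<Rightarrow> 'v \<Rightarrow> bool" where
  "simple_path E i p j \<longleftrightarrow>
     p \<noteq> [] \<and> hd p = i \<and> last p = j \<and> distinct p \<and> successively E p"

definition graph_cycle :: "('v \<Rightarrow> 'v \<Rightarrow> bool) \<Rightarrow> 'v list \<Rightarrow> bool" where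
  "graph_cycle E c \<longleftrightarrow>
     length c \<ge> 3 \<and> distinct c \<and> successively E c \<and> E (last c) (hd c)"

definition is_tree :: "('v \<Rightarrow> 'v \<Rightarrow> bool) \<Rightarrow> bool" where
  "is_tree E \<longleftrightarrow>
     simple_graph E \<and> (\<forall>i j. \<exists>p. simple_path E i p j) \<and> \<not> (\<exists>c. graph_cycle E c)"

text \<open>Nodes strictly between \<open>i\<close> and \<open>j\<close>; in a tree the path \<open>p\<close> is unique.\<close>

definition between :: "('v \<Rightarrow> 'v \<Rightarrow> bool) \<Rightarrow> 'v \<Rightarrow> 'v \<Rightarrow> 'v set" where
  "between E i j = {k. \<exists>p. simple_path E i p j \<and> k \<in> set p} - {i, j}"

definition graph_components :: "('v \<Rightarrow> 'v \<Rightarrow> bool) \<Rightarrow> 'v set \<Rightarrow> 'v set set" where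
  "graph_components E S =
     S // {(i, j). i \<in> S \<and> j \<in> S \<and> (\<exists>p. simple_path E i p j \<and> set p \<subseteq> S)}"

datatype (nodes: 'v) rtree = Node 'v "'v rtree fset"

text \<open>\<open>is_stt E C T\<close>: \<open>T\<close> is a search tree over the subgraph induced by \<open>C\<close>. The function \<open>f\<close> assigns
  to each component of \<open>C - {r}\<close> the search tree chosen for it.\<close>

inductive is_stt :: "('v \<Rightarrow> 'v \<Rightarrow> bool) \<Rightarrow> 'v set \<Rightarrow> 'v rtree \<Rightarrow> bool" for E where
  "\<lbrakk>r \<in> C;
    fset ts = f ` graph_components E (C - {r});
    \<And>K. K \<in> graph_components E (C - {r}) \<Longrightarrow> is_stt E K (f K)\<rbrakk>
   \<Longrightarrow> is_stt E C (Node r ts)"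

inductive proper_ancestor :: "'v rtree \<Rightarrow> 'v \<Rightarrow> 'v \<Rightarrow> bool" where
  root: "\<lbrakk>t |\<in>| ts; j \<in> nodes t\<rbrakk> \<Longrightarrow> proper_ancestor (Node r ts) r j"
| sub: "\<lbrakk>t |\<in>| ts; proper_ancestor t i j\<rbrakk> \<Longrightarrow> proper_ancestor (Node r ts) i j"

definition ancestor_eq :: "'v rtree \<Rightarrow> 'v \<Rightarrow> 'v \<Rightarrow> bool" where
  "ancestor_eq T i j \<longleftrightarrow> (i = j \<and> i \<in> nodes T) \<or> proper_ancestor T i j"

definition is_lca :: "'v rtree \<Rightarrow> 'v \<Rightarrow> 'v \<Rightarrow> 'v \<Rightarrow> bool" where
  "is_lca T k i j \<longleftrightarrow>
     ancestor_eq T k i \<and> ancestor_eq T k j \<and>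
     (\<forall>m. ancestor_eq T m i \<and> ancestor_eq T m j \<longrightarrow> ancestor_eq T m k)"

text \<open>A point is a triple \<open>(D, X, Z)\<close> with \<open>D\<^sub>i = D $ i\<close>, \<open>X\<^sub>i\<^sub>j = X $ i $ j\<close> and
  \<open>Z\<^sub>k\<^sub>i\<^sub>j = Z $ k $ i $ j\<close>.  The entries \<open>X $ i $ i\<close> and \<open>Z $ k $ i $ j\<close> with \<open>k\<close> not strictly between
  \<open>i\<close> and \<open>j\<close> are not variables of the LP; they are fixed to \<open>0\<close>, and \<open>Z $ k $ i $ j\<close> and
  \<open>Z $ k $ j $ i\<close> are one variable.\<close>

type_synonym 'v lp_point = "(real ^ 'v) \<times> (real ^ 'v ^ 'v) \<times> (real ^ 'v ^ 'v ^ 'v)"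

definition lp_space :: "('v \<Rightarrow> 'v \<Rightarrow> bool) \<Rightarrow> ('v::finite) lp_point set" where
  "lp_space E = {(D, X, Z).
     (\<forall>i. X $ i $ i = 0) \<and>
     (\<forall>i j k. k \<notin> between E i j \<longrightarrow> Z $ k $ i $ j = 0) \<and>
     (\<forall>i j k. Z $ k $ i $ j = Z $ k $ j $ i)}"

definition stt_polyhedron :: "('v \<Rightarrow> 'v \<Rightarrow> bool) \<Rightarrow> ('v::finite) lp_point set" where
  "stt_polyhedron E = {(D, X, Z). (D, X, Z) \<in> lp_space E \<and>
     (\<forall>i j. i \<noteq> j \<longrightarrow> X $ i $ j \<ge> 0) \<and>
     (\<forall>i j. i \<noteq> j \<longrightarrow> (\<forall>k\<in>between E i j. Z $ k $ i $ j \<ge> 0)) \<and>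
     (\<forall>i j. i \<noteq> j \<longrightarrow> X $ i $ j + X $ j $ i + (\<Sum>k\<in>between E i j. Z $ k $ i $ j) \<ge> 1) \<and>
     (\<forall>i j. i \<noteq> j \<longrightarrow> (\<forall>k\<in>between E i j.
        Z $ k $ i $ j \<le> X $ k $ i \<and> Z $ k $ i $ j \<le> X $ k $ j)) \<and>
     (\<forall>i. D $ i \<ge> (\<Sum>j\<in>UNIV - {i}. X $ j $ i))}"

definition integer_point :: "('v::finite) lp_point \<Rightarrow> bool" where
  "integer_point P \<longleftrightarrow> (case P of (D, X, Z) \<Rightarrow>
     (\<forall>i. D $ i \<in> \<int>) \<and> (\<forall>i j. X $ i $ j \<in> \<int>) \<and> (\<forall>k i j. Z $ k $ i $ j \<in> \<int>))"

definition induced_by :: "('v \<Rightarrow> 'v \<Rightarrow> bool) \<Rightarrow> 'v rtree \<Rightarrow> ('v::finite) lp_point \<Rightarrow> bool" where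
  "induced_by E T P \<longleftrightarrow> (case P of (D, X, Z) \<Rightarrow>
     (D, X, Z) \<in> lp_space E \<and>
     (\<forall>i j. i \<noteq> j \<longrightarrow> X $ i $ j = (if proper_ancestor T i j then 1 else 0)) \<and>
     (\<forall>i j. i \<noteq> j \<longrightarrow> (\<forall>k\<in>between E i j. Z $ k $ i $ j = (if is_lca T k i j then 1 else 0))) \<and>
     (\<forall>i. D $ i = (\<Sum>j\<in>UNIV - {i}. X $ j $ i)))"

text \<open>The parameter \<open>d\<close> extracts the \<open>D\<close> coordinates, so that the same notion applies to the
  polyhedron (\<open>d = fst\<close>) and to its projection (\<open>d = id\<close>). Vertices are extreme points.\<close>

definition lower_envelope_vertex ::
  "('a::real_vector \<Rightarrow> real ^ ('v::finite)) \<Rightarrow> 'a set \<Rightarrow> 'a \<Rightarrow> bool" where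
  "lower_envelope_vertex d S P \<longleftrightarrow> P extreme_point_of S \<and>
     (\<exists>w :: real ^ 'v. (\<forall>i. w $ i \<ge> 0) \<and>
        (\<forall>Q. is_arg_min (\<lambda>q. \<Sum>i\<in>UNIV. w $ i * d q $ i) (\<lambda>q. q \<in> S) Q \<longleftrightarrow> Q = P))"

end

theory Submission
  imports Defs
begin

text \<open>
  Let \<open>T\<close> be an STT. If \<open>a\<close> is a proper ancestor of \<open>i\<close>, then all nodes between them are descendants
  of \<open>a\<close>, so the constraints give \<open>X\<^sub>a\<^sub>i \<ge> 1 - s\<^sub>a\<close>, where the inversion \<open>s\<^sub>a\<close> is the sum of \<open>X\<^sub>d\<^sub>a\<close>
  over the descendants \<open>d\<close> of \<open>a\<close>. Thus a positive \<open>s\<^sub>a\<close> costs \<open>s\<^sub>a\<close> at \<open>a\<close> and saves at most \<open>s\<^sub>a\<close>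
  at each descendant. If every node weighs more than all its proper descendants together, then \<open>s\<close>
  vanishes at an optimum, which forces first \<open>D\<close>, then \<open>X\<close> and finally \<open>Z\<close> to agree with \<open>T\<close>.

  Conversely, every integer point is dominated in all \<open>D\<close> coordinates by the point of some STT. In a
  connected set \<open>C\<close> let \<open>H\<^sub>j\<close> be the subtree spanned by \<open>j\<close> and all \<open>a\<close> in \<open>C\<close> with \<open>X\<^sub>a\<^sub>j \<ge> 1\<close>. By
  the constraints these subtrees meet pairwise, so by the Helly property of subtrees they share a
  node \<open>r\<close>. Make \<open>r\<close> the root: every other \<open>j\<close> has some \<open>a\<close> with \<open>X\<^sub>a\<^sub>j \<ge> 1\<close> outside its component
  of \<open>C - {r}\<close>, which pays for the level that \<open>r\<close> adds to the depth of \<open>j\<close>; recurse into the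
  components. If \<open>P\<^sub>D\<close> is a unique minimizer, it equals the \<open>D\<close> part of this STT, whose point is
  determined by its \<open>D\<close> part.
\<close>

section \<open>Simple paths\<close>

lemma successively_rev_symp: "symp E \<Longrightarrow> successively E (rev p) \<longleftrightarrow> successively E p"
  unfolding successively_rev by (rule successively_cong) (auto dest: sympD)

lemma simple_path_rev:
  assumes "symp E" "simple_path E i p j"
  shows "simple_path E j (rev p) i"
  using assms unfolding simple_path_def
  by (simp add: successively_rev_symp hd_rev last_rev del: successively_rev)

lemma simple_path_same_ends:
  assumes "simple_path E i p i"
  shows "p = [i]"
  using assms unfolding simple_path_def
  by (metis distinct.simps(2) last.simps last_in_set list.exhaust_sel)

lemma simple_path_Cons_iff:
  "simple_path E i (a # p) j \<longleftrightarrow>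
     a = i \<and> (if p = [] then i = j else E i (hd p) \<and> i \<notin> set p \<and> simple_path E (hd p) p j)"
  by (auto simp: simple_path_def successively_Cons)

lemma simple_path_appendD1: "simple_path E i (p @ k # q) j \<Longrightarrow> simple_path E i (p @ [k]) k"
  by (auto simp: simple_path_def successively_append_iff hd_append)

lemma between_self [simp]: "between E i i = {}"
proof -
  have "set p = {i}" if "simple_path E i p i" for p
    using simple_path_same_ends[OF that] by simp
  then show ?thesis unfolding between_def by blast
qed

lemma lists_meetE:
  assumes "set p \<inter> set q \<noteq> {}"
  obtains p1 x p2 q1 q2 where "p = p1 @ x # p2" "q = q1 @ x # q2" "set p1 \<inter> set q = {}"
proof -
  have "\<exists>x\<in>set p. x \<in> set q" using assms by blast
  then obtain p1 x p2 where p: "p = p1 @ x # p2" and x: "x \<in> set q" and "\<forall>y\<in>set p1. y \<notin> set q"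
    using split_list_first_prop[of p "\<lambda>x. x \<in> set q"] by blast
  moreover obtain q1 q2 where "q = q1 @ x # q2" using split_list[OF x] by blast
  ultimately show thesis using that by blast
qed

lemma simple_path_joinE:
  assumes p: "simple_path E i p m" and q: "simple_path E m q j"
  obtains s x where "simple_path E i s j" "set s \<subseteq> set p \<union> set q" "x \<in> set p \<inter> set q \<inter> set s"
proof -
  have "m \<in> set p \<inter> set q"
    using p q unfolding simple_path_def by (metis IntI hd_in_set last_in_set)
  then obtain p1 x p2 q1 q2 where split: "p = p1 @ x # p2" "q = q1 @ x # q2" "set p1 \<inter> set q = {}"
    using lists_meetE[of p q] by blast
  then have "simple_path E i (p1 @ x # q2) j"
    using p q unfolding simple_path_def by (auto simp: successively_append_iff hd_append)
  then show thesis using split by (intro that[of "p1 @ x # q2" x]) auto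
qed

lemma diverging_paths_cycle:
  assumes sym: "symp E"
    and p: "simple_path E i (i # p) j" "p \<noteq> []"
    and q: "simple_path E i (i # q) j" "q \<noteq> []"
    and diverge: "hd p \<noteq> hd q"
  shows "\<exists>c. graph_cycle E c"
proof -
  have distinct: "distinct (i # p)" "distinct (i # q)"
    and walk: "successively E (i # p)" "successively E (i # q)"
    and "last p = last q"
    using p q unfolding simple_path_def by simp_all
  then have "last p \<in> set p \<inter> set q" using p(2) q(2) by (metis IntI last_in_set)
  then obtain p1 x p2 q1 q2 where split: "p = p1 @ x # p2" "q = q1 @ x # q2"
    and disjoint: "set p1 \<inter> set q = {}"
    using lists_meetE[of p q] by blast
  let ?c = "i # p1 @ x # rev q1"
  have "p1 \<noteq> [] \<or> q1 \<noteq> []" using diverge split by auto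
  then have "length ?c \<ge> 3" by (cases p1; cases q1) auto
  moreover have "distinct ?c" using distinct disjoint unfolding split by auto
  moreover have "successively E ?c"
  proof -
    have "successively E (i # p1 @ [x])" "successively E (q1 @ [x])"
      using walk unfolding split by (auto simp: successively_append_iff successively_Cons hd_append)
    then have "successively E ((i # p1) @ [x])" "successively E (x # rev q1)"
      using successively_rev_symp[OF sym, of "q1 @ [x]"] by (simp_all del: successively_rev)
    then show ?thesis
      using successively_append_iff[of E "i # p1" "x # rev q1"]
        successively_append_iff[of E "i # p1" "[x]"] by simp
  qed
  moreover have "E (last ?c) (hd ?c)"
  proof -
    have "E i (hd q)" using q by (simp add: simple_path_Cons_iff)
    moreover have "last ?c = hd q" using split(2) by (cases q1) auto
    ultimately show ?thesis using sympD[OF sym] by simp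
  qed
  ultimately show ?thesis unfolding graph_cycle_def by blast
qed

lemma simple_path_unique:
  assumes sym: "symp E" and acyclic: "\<nexists>c. graph_cycle E c"
    and "simple_path E i p j" "simple_path E i q j"
  shows "p = q"
  using assms(3,4)
proof (induction p arbitrary: i q)
  case Nil
  then show ?case by (simp add: simple_path_def)
next
  case (Cons a p)
  then have a: "a = i" by (simp add: simple_path_Cons_iff)
  show ?case
  proof (cases "i = j")
    case True
    then show ?thesis using Cons.prems simple_path_same_ends by metis
  next
    case False
    obtain q' where q: "q = i # q'"
      using Cons.prems(2) unfolding simple_path_def by (metis list.collapse)
    have nonempty: "p \<noteq> []" "q' \<noteq> []"
      using Cons.prems False unfolding q by (auto simp: simple_path_Cons_iff)
    then have "hd p = hd q'"
      using diverging_paths_cycle[OF sym] acyclic Cons.prems unfolding a q by blast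
    then have "p = q'"
      using Cons.IH[of "hd p" q'] Cons.prems nonempty unfolding q
      by (auto simp: simple_path_Cons_iff)
    then show ?thesis using a q by simp
  qed
qed

section \<open>Search trees over graphs\<close>

definition depth :: "'v rtree \<Rightarrow> 'v \<Rightarrow> nat" where
  "depth T j = card {a. proper_ancestor T a j}"

definition covers_pairs :: "('v \<Rightarrow> 'v \<Rightarrow> bool) \<Rightarrow> 'v set \<Rightarrow> ('v \<Rightarrow> 'v \<Rightarrow> bool) \<Rightarrow> bool" where
  "covers_pairs E C N \<longleftrightarrow>
     (\<forall>i\<in>C. \<forall>j\<in>C. i \<noteq> j \<longrightarrow> N i j \<or> N j i \<or> (\<exists>k\<in>between E i j. N k i \<and> N k j))"

lemma covers_pairs_subset: "covers_pairs E C N \<Longrightarrow> K \<subseteq> C \<Longrightarrow> covers_pairs E K N"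
  unfolding covers_pairs_def by blast

lemma finite_nodes: "finite (nodes T)"
  by (induction T) auto

lemma proper_ancestor_Node_iff:
  "proper_ancestor (Node r ts) i j \<longleftrightarrow>
     (i = r \<and> (\<exists>t\<in>fset ts. j \<in> nodes t)) \<or> (\<exists>t\<in>fset ts. proper_ancestor t i j)"
  by (subst proper_ancestor.simps) auto

lemma proper_ancestor_nodes:
  "proper_ancestor T i j \<Longrightarrow> i \<in> nodes T \<and> j \<in> nodes T"
  by (induction rule: proper_ancestor.induct) auto

locale undirected_graph =
  fixes E :: "'v \<Rightarrow> 'v \<Rightarrow> bool"
  assumes symp_edges: "symp E"
begin

definition connection :: "'v set \<Rightarrow> ('v \<times> 'v) set" where
  "connection S = {(i, j). i \<in> S \<and> j \<in> S \<and> (\<exists>p. simple_path E i p j \<and> set p \<subseteq> S)}"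

lemma graph_components_eq_quotient: "graph_components E S = S // connection S"
  by (simp add: graph_components_def connection_def)

lemma equiv_connection: "equiv S (connection S)"
proof (rule equivI)
  show "connection S \<subseteq> S \<times> S" by (auto simp: connection_def)
  show "refl_on S (connection S)"
  proof (rule refl_onI)
    fix i assume "i \<in> S"
    moreover have "simple_path E i [i] i" by (simp add: simple_path_def)
    ultimately show "(i, i) \<in> connection S"
      unfolding connection_def by (auto intro!: exI[of _ "[i]"])
  qed
  show "sym (connection S)"
  proof (rule symI)
    fix i j assume "(i, j) \<in> connection S"
    then obtain p where "i \<in> S" "j \<in> S" "simple_path E j (rev p) i" "set (rev p) \<subseteq> S"
      unfolding connection_def using simple_path_rev[OF symp_edges] by auto
    then show "(j, i) \<in> connection S" unfolding connection_def by blast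
  qed
  show "trans (connection S)"
  proof (rule transI)
    fix i m j assume "(i, m) \<in> connection S" "(m, j) \<in> connection S"
    then obtain p q where "i \<in> S" "j \<in> S" "simple_path E i p m" "simple_path E m q j"
      "set p \<union> set q \<subseteq> S"
      unfolding connection_def by blast
    moreover from this obtain s where "simple_path E i s j" "set s \<subseteq> set p \<union> set q"
      by (meson simple_path_joinE)
    ultimately show "(i, j) \<in> connection S" unfolding connection_def by blast
  qed
qed

lemma Union_components: "\<Union>(graph_components E S) = S"
  unfolding graph_components_eq_quotient by (rule Union_quotient[OF equiv_connection])

lemma component_subset: "K \<in> graph_components E S \<Longrightarrow> K \<subseteq> S"
  using Union_components by blast

lemma component_nonempty: "K \<in> graph_components E S \<Longrightarrow> K \<noteq> {}"
  unfolding graph_components_eq_quotient by (rule in_quotient_imp_non_empty[OF equiv_connection])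

lemma component_unique:
  "K \<in> graph_components E S \<Longrightarrow> K' \<in> graph_components E S \<Longrightarrow> i \<in> K \<Longrightarrow> i \<in> K' \<Longrightarrow> K = K'"
  unfolding graph_components_eq_quotient using quotient_disj[OF equiv_connection] by blast

lemma component_eq_class:
  assumes "K \<in> graph_components E S" "i \<in> K"
  shows "K = connection S `` {i}"
  using assms unfolding graph_components_eq_quotient
  by (metis Image_singleton_iff equiv_class_eq equiv_connection quotientE)

lemma nodes_is_stt: "is_stt E C T \<Longrightarrow> nodes T = C"
proof (induction rule: is_stt.induct)
  case (1 r C ts f)
  then have "nodes (Node r ts) = insert r (\<Union>(graph_components E (C - {r})))" by simp
  then show ?case using "1.hyps"(1) by (simp add: Union_components insert_absorb)
qed

context
  fixes C r ts f
  assumes subtrees: "fset ts = f ` graph_components E (C - {r})"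
    and stt: "\<forall>K\<in>graph_components E (C - {r}). is_stt E K (f K)"
begin

lemma proper_ancestor_Node:
  "proper_ancestor (Node r ts) a j \<longleftrightarrow>
    (\<exists>K\<in>graph_components E (C - {r}). j \<in> K \<and> (a = r \<or> proper_ancestor (f K) a j))"
proof -
  have "nodes (f K) = K" if "K \<in> graph_components E (C - {r})" for K
    using nodes_is_stt stt that by blast
  then show ?thesis
    using proper_ancestor_nodes[of "f _" a j] unfolding proper_ancestor_Node_iff subtrees by blast
qed

lemma depth_root: "depth (Node r ts) r = 0"
proof -
  have "\<not> proper_ancestor (Node r ts) a r" for a
    using component_subset unfolding proper_ancestor_Node by blast
  then show ?thesis by (simp add: depth_def)
qed

lemma depth_component:
  assumes K: "K \<in> graph_components E (C - {r})" "j \<in> K"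
  shows "depth (Node r ts) j = Suc (depth (f K) j)"
proof -
  have "proper_ancestor (Node r ts) a j \<longleftrightarrow> a = r \<or> proper_ancestor (f K) a j" for a
    using component_unique[OF K(1) _ K(2)] K proper_ancestor_Node by metis
  then have "{a. proper_ancestor (Node r ts) a j} = insert r {a. proper_ancestor (f K) a j}"
    by blast
  moreover have ancestors: "{a. proper_ancestor (f K) a j} \<subseteq> nodes (f K)"
    by (auto dest: proper_ancestor_nodes)
  then have "finite {a. proper_ancestor (f K) a j}" by (rule finite_subset) (rule finite_nodes)
  moreover have "r \<notin> nodes (f K)"
    using nodes_is_stt stt K(1) component_subset[OF K(1)] by blast
  then have "r \<notin> {a. proper_ancestor (f K) a j}" using ancestors by blast
  ultimately show ?thesis unfolding depth_def by simp
qed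

end

lemma stt_NodeE:
  assumes "finite C" "r \<in> C"
    and stt: "\<forall>K\<in>graph_components E (C - {r}). is_stt E K (f K)"
  obtains T where "is_stt E C T" "depth T r = 0"
    "\<And>K j. K \<in> graph_components E (C - {r}) \<Longrightarrow> j \<in> K \<Longrightarrow> depth T j = Suc (depth (f K) j)"
proof -
  have "graph_components E (C - {r}) \<subseteq> Pow C" using component_subset by blast
  then have "finite (graph_components E (C - {r}))" using assms(1) by (simp add: finite_subset)
  then obtain ts where subtrees: "fset ts = f ` graph_components E (C - {r})"
    by (metis finite_imageI fset_cases mem_Collect_eq)
  show thesis
  proof (rule that)
    show "is_stt E C (Node r ts)" by (rule is_stt.intros[OF assms(2) subtrees stt[rule_format]])
  qed (fact depth_root[OF subtrees stt], rule depth_component[OF subtrees stt])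
qed

lemma is_stt_induct [consumes 1, case_names Node]:
  assumes "is_stt E C T"
    and "\<And>r C ts f. \<lbrakk>r \<in> C;
      \<And>K. K \<in> graph_components E (C - {r}) \<Longrightarrow> is_stt E K (f K);
      \<And>a j. proper_ancestor (Node r ts) a j \<longleftrightarrow>
        (\<exists>K\<in>graph_components E (C - {r}). j \<in> K \<and> (a = r \<or> proper_ancestor (f K) a j));
      \<And>K. K \<in> graph_components E (C - {r}) \<Longrightarrow> Q K (f K)\<rbrakk> \<Longrightarrow> Q C (Node r ts)"
  shows "Q C T"
  using assms(1)
proof (induction rule: is_stt.induct)
  case (1 r C ts f)
  have "\<forall>K\<in>graph_components E (C - {r}). is_stt E K (f K)" using "1.hyps"(3) by blast
  from "1.hyps"(1,3) proper_ancestor_Node[OF "1.hyps"(2) this] "1.IH"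
  show ?case by (rule assms(2))
qed

lemma proper_ancestor_mem:
  "is_stt E C T \<Longrightarrow> proper_ancestor T i j \<Longrightarrow> i \<in> C \<and> j \<in> C"
  using nodes_is_stt proper_ancestor_nodes by metis

lemma proper_ancestor_irrefl: "is_stt E C T \<Longrightarrow> \<not> proper_ancestor T i i"
proof (induction rule: is_stt_induct)
  case (Node r C ts f)
  show ?case unfolding Node.hyps(3) using Node.IH component_subset by blast
qed

lemma proper_ancestor_trans:
  "is_stt E C T \<Longrightarrow> proper_ancestor T i j \<Longrightarrow> proper_ancestor T j k \<Longrightarrow> proper_ancestor T i k"
proof (induction rule: is_stt_induct)
  case (Node r C ts f)
  note stt = Node.hyps(2) and ancestor_iff = Node.hyps(3)
  obtain K' where K': "K' \<in> graph_components E (C - {r})" "j \<in> K'"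
    and above_j: "i = r \<or> proper_ancestor (f K') i j"
    using Node.prems(1) unfolding ancestor_iff by blast
  obtain K where K: "K \<in> graph_components E (C - {r})" "k \<in> K"
    and above_k: "j = r \<or> proper_ancestor (f K) j k"
    using Node.prems(2) unfolding ancestor_iff by blast
  have j_above_k: "proper_ancestor (f K) j k" using above_k K' component_subset by blast
  then have "j \<in> K" using proper_ancestor_mem[OF stt[OF K(1)]] by blast
  then have "K' = K" using component_unique[OF K'(1) K(1) K'(2)] by blast
  then have "i = r \<or> proper_ancestor (f K) i k" using above_j j_above_k Node.IH[OF K(1)] by blast
  then show ?case using K unfolding ancestor_iff by blast
qed

end

section \<open>Path-convex sets and the Helly property\<close>

locale tree_topology =
  fixes U :: "'v \<Rightarrow> 'v \<Rightarrow> bool"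
  assumes tree: "is_tree U"

sublocale tree_topology \<subseteq> undirected_graph U
  using tree by unfold_locales (simp add: is_tree_def simple_graph_def)

context tree_topology
begin

definition segment :: "'v \<Rightarrow> 'v \<Rightarrow> 'v set" where
  "segment i j = {k. \<exists>p. simple_path U i p j \<and> k \<in> set p}"

definition path_convex :: "'v set \<Rightarrow> bool" where
  "path_convex C \<longleftrightarrow> (\<forall>i\<in>C. \<forall>j\<in>C. segment i j \<subseteq> C)"

lemma between_eq_segment: "between U i j = segment i j - {i, j}"
  by (simp add: between_def segment_def)

lemma segment_eq_set:
  assumes "simple_path U i p j"
  shows "segment i j = set p"
  using assms simple_path_unique[OF symp_edges _ assms] tree
  unfolding segment_def is_tree_def by blast

lemma segment_pathE:
  obtains p where "simple_path U i p j" "segment i j = set p"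
  using tree segment_eq_set unfolding is_tree_def by metis

lemma segment_endpoints [simp]: "i \<in> segment i j" "j \<in> segment i j"
  using segment_pathE[of i j] unfolding simple_path_def by (metis hd_in_set last_in_set)+

lemma segment_self [simp]: "segment i i = {i}"
  using segment_eq_set[of i "[i]" i] by (simp add: simple_path_def)

lemma segment_sym: "segment i j = segment j i"
  by (metis symp_edges segment_eq_set segment_pathE set_rev simple_path_rev)

lemma between_sym: "between U i j = between U j i"
  by (auto simp: between_eq_segment segment_sym[of i j])

lemma segment_median:
  "segment i m \<inter> segment m j \<inter> segment i j \<noteq> {}"
  and segment_triangle: "segment i j \<subseteq> segment i m \<union> segment m j"
proof -
  obtain p q where "simple_path U i p m" "segment i m = set p"
    "simple_path U m q j" "segment m j = set q"
    by (meson segment_pathE)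
  then obtain s x where "simple_path U i s j" "set s \<subseteq> segment i m \<union> segment m j"
    "x \<in> segment i m \<inter> segment m j \<inter> set s"
    using simple_path_joinE by metis
  then show "segment i m \<inter> segment m j \<inter> segment i j \<noteq> {}"
    "segment i j \<subseteq> segment i m \<union> segment m j"
    using segment_eq_set by blast+
qed

lemma subsegment:
  assumes "k \<in> segment i j"
  shows "segment i k \<subseteq> segment i j"
proof -
  obtain p where p: "simple_path U i p j" "segment i j = set p" by (rule segment_pathE)
  obtain p1 p2 where split: "p = p1 @ k # p2" using assms p by (metis split_list)
  then have "segment i k = set (p1 @ [k])" using p(1) simple_path_appendD1 segment_eq_set by metis
  then show ?thesis using p(2) split by auto
qed

lemma path_convexD: "path_convex C \<Longrightarrow> i \<in> C \<Longrightarrow> j \<in> C \<Longrightarrow> segment i j \<subseteq> C"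
  by (simp add: path_convex_def)

lemma path_convex_UNIV: "path_convex UNIV"
  by (simp add: path_convex_def)

lemma path_convex_Int: "path_convex A \<Longrightarrow> path_convex B \<Longrightarrow> path_convex (A \<inter> B)"
  unfolding path_convex_def by blast

lemma path_convex_star: "path_convex (\<Union>a\<in>A. segment a j)"
  unfolding path_convex_def
proof (intro ballI)
  fix x y assume "x \<in> (\<Union>a\<in>A. segment a j)" "y \<in> (\<Union>a\<in>A. segment a j)"
  then obtain a b where "a \<in> A" "b \<in> A" "x \<in> segment j a" "y \<in> segment j b"
    using segment_sym by blast
  then have "segment j x \<subseteq> segment a j" "segment j y \<subseteq> segment b j"
    using subsegment segment_sym by metis+
  then show "segment x y \<subseteq> (\<Union>a\<in>A. segment a j)"
    using segment_triangle[of x y j] segment_sym[of x j] \<open>a \<in> A\<close> \<open>b \<in> A\<close> by blast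
qed

lemma path_convex_Int3_nonempty:
  assumes "path_convex A" "path_convex B" "path_convex C"
    and "A \<inter> B \<noteq> {}" "B \<inter> C \<noteq> {}" "A \<inter> C \<noteq> {}"
  shows "A \<inter> B \<inter> C \<noteq> {}"
proof -
  obtain x y z where xyz: "x \<in> A \<inter> B" "y \<in> B \<inter> C" "z \<in> A \<inter> C" using assms(4-6) by blast
  obtain m where "m \<in> segment x y \<inter> segment y z \<inter> segment x z" using segment_median by blast
  then have "m \<in> A \<inter> B \<inter> C"
    using xyz assms(1-3)[THEN path_convexD] by blast
  then show ?thesis by blast
qed

lemma path_convex_Helly:
  assumes "finite I" "I \<noteq> {}"
    and "\<And>i. i \<in> I \<Longrightarrow> path_convex (H i)"
    and "\<And>i j. i \<in> I \<Longrightarrow> j \<in> I \<Longrightarrow> H i \<inter> H j \<noteq> {}"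
  shows "(\<Inter>i\<in>I. H i) \<noteq> {}"
  using assms
proof (induction arbitrary: H rule: finite_ne_induct)
  case (singleton k)
  then show ?case by simp
next
  case (insert k I)
  have "(\<Inter>i\<in>I. H k \<inter> H i) \<noteq> {}"
  proof (rule insert.IH)
    show "path_convex (H k \<inter> H i)" if "i \<in> I" for i
      using insert.prems(1) that by (simp add: path_convex_Int)
    show "(H k \<inter> H i) \<inter> (H k \<inter> H j) \<noteq> {}" if "i \<in> I" "j \<in> I" for i j
      using path_convex_Int3_nonempty[of "H k" "H i" "H j"] insert.prems that by blast
  qed
  then show ?case using insert.hyps(2) by auto
qed

lemma component_segment:
  assumes "K \<in> graph_components U S" "i \<in> K"
  shows "j \<in> K \<longleftrightarrow> segment i j \<subseteq> S"
proof -
  obtain p where "simple_path U i p j" "segment i j = set p" by (rule segment_pathE)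
  then have "(\<exists>p. simple_path U i p j \<and> set p \<subseteq> S) \<longleftrightarrow> segment i j \<subseteq> S"
    using segment_eq_set by blast
  moreover have "i \<in> S" "j \<in> S" if "segment i j \<subseteq> S" using that segment_endpoints by blast+
  ultimately have "(i, j) \<in> connection S \<longleftrightarrow> segment i j \<subseteq> S"
    unfolding connection_def by blast
  then show ?thesis using component_eq_class[OF assms] by (metis Image_singleton_iff)
qed

lemma component_path_convex:
  assumes "K \<in> graph_components U S"
  shows "path_convex K"
  unfolding path_convex_def
proof (intro ballI subsetI)
  fix i j k assume "i \<in> K" "j \<in> K" "k \<in> segment i j"
  then show "k \<in> K" using component_segment[OF assms \<open>i \<in> K\<close>] subsegment by blast
qed

section \<open>Search trees over a tree topology\<close>

lemma proper_ancestor_between: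
  "is_stt U C T \<Longrightarrow> path_convex C \<Longrightarrow> proper_ancestor T a i \<Longrightarrow> k \<in> between U a i
    \<Longrightarrow> proper_ancestor T a k"
proof (induction rule: is_stt_induct)
  case (Node r C ts f)
  note ancestor_iff = Node.hyps(3)
  obtain K where K: "K \<in> graph_components U (C - {r})" "i \<in> K"
    and a: "a = r \<or> proper_ancestor (f K) a i"
    using Node.prems(2) unfolding ancestor_iff by blast
  have k: "k \<in> segment a i" "k \<noteq> a" using Node.prems(3) by (auto simp: between_eq_segment)
  show ?case
  proof (cases "a = r")
    case True
    have "i \<in> C" using component_subset[OF K(1)] K(2) by blast
    then have "k \<in> C - {r}"
      using path_convexD[OF Node.prems(1) Node.hyps(1)] k unfolding True by blast
    then obtain K' where "K' \<in> graph_components U (C - {r})" "k \<in> K'"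
      using Union_components[of "C - {r}"] by blast
    then show ?thesis using True unfolding ancestor_iff by blast
  next
    case False
    then have ai: "proper_ancestor (f K) a i" using a by blast
    then have "a \<in> K" using proper_ancestor_mem[OF Node.hyps(2)[OF K(1)]] by blast
    then have "k \<in> K"
      using path_convexD[OF component_path_convex[OF K(1)] _ K(2)] k(1) by blast
    moreover have "proper_ancestor (f K) a k"
      using Node.IH[OF K(1) component_path_convex[OF K(1)] ai] Node.prems(3) .
    ultimately show ?thesis using K(1) unfolding ancestor_iff by blast
  qed
qed

lemma proper_ancestor_covers_pairs:
  "is_stt U C T \<Longrightarrow> path_convex C \<Longrightarrow> covers_pairs U C (proper_ancestor T)"
proof (induction rule: is_stt_induct)
  case (Node r C ts f)
  note ancestor_iff = Node.hyps(3)
  have root: "proper_ancestor (Node r ts) r j" if "j \<in> C - {r}" for j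
    using that Union_components[of "C - {r}"] unfolding ancestor_iff by blast
  show ?case unfolding covers_pairs_def
  proof (intro ballI impI)
    fix i j assume ij: "i \<in> C" "j \<in> C" "i \<noteq> j"
    show "proper_ancestor (Node r ts) i j \<or> proper_ancestor (Node r ts) j i \<or>
      (\<exists>k\<in>between U i j. proper_ancestor (Node r ts) k i \<and> proper_ancestor (Node r ts) k j)"
    proof (cases "r \<in> segment i j")
      case True
      then show ?thesis using root ij unfolding between_eq_segment by blast
    next
      case False
      then have avoids: "segment i j \<subseteq> C - {r}"
        using path_convexD[OF Node.prems ij(1,2)] by blast
      moreover have "i \<in> segment i j" by simp
      ultimately obtain K where K: "K \<in> graph_components U (C - {r})" "i \<in> K"
        using Union_components[of "C - {r}"] by blast
      then have "j \<in> K" using component_segment avoids by simp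
      moreover have "covers_pairs U K (proper_ancestor (f K))"
        using Node.IH K(1) component_path_convex by blast
      ultimately have "proper_ancestor (f K) i j \<or> proper_ancestor (f K) j i \<or>
        (\<exists>k\<in>between U i j. proper_ancestor (f K) k i \<and> proper_ancestor (f K) k j)"
        using K(2) ij(3) unfolding covers_pairs_def by blast
      moreover have "proper_ancestor (Node r ts) a b" if "b \<in> K" "proper_ancestor (f K) a b" for a b
        using that K(1) unfolding ancestor_iff by blast
      ultimately show ?thesis using K(2) \<open>j \<in> K\<close> by blast
    qed
  qed
qed

lemma dominating_root:
  assumes "finite C" "C \<noteq> {}" "path_convex C" and covers: "covers_pairs U C N"
  obtains r where "r \<in> C" "\<And>j. j \<in> C - {r} \<Longrightarrow> \<exists>a\<in>C. N a j \<and> r \<in> segment a j"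
proof -
  define covering where "covering j = insert j {a \<in> C. N a j}" for j
  define subtree where "subtree j = (\<Union>a\<in>covering j. segment a j)" for j
  have "subtree i \<inter> subtree j \<noteq> {}" if "i \<in> C" "j \<in> C" for i j
  proof -
    have "between U i j \<subseteq> C"
      using path_convexD[OF assms(3) that] unfolding between_eq_segment by blast
    moreover have "i = j \<or> N i j \<or> N j i \<or> (\<exists>k\<in>between U i j. N k i \<and> N k j)"
      using covers that unfolding covers_pairs_def by blast
    ultimately have "\<exists>a. a \<in> covering i \<and> a \<in> covering j" using that unfolding covering_def by auto
    then obtain a where "a \<in> covering i" "a \<in> covering j" by blast
    then have "a \<in> subtree i \<inter> subtree j" unfolding subtree_def by (auto intro: bexI[of _ a])
    then show ?thesis by blast
  qed
  then have "(\<Inter>j\<in>C. subtree j) \<noteq> {}"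
    using assms(1,2) path_convex_star unfolding subtree_def by (intro path_convex_Helly)
  then obtain r where r: "\<And>j. j \<in> C \<Longrightarrow> r \<in> subtree j" by blast
  have "subtree j \<subseteq> C" if "j \<in> C" for j
    using path_convexD[OF assms(3) _ that] that unfolding subtree_def covering_def by blast
  then have "r \<in> C" using r assms(2) by blast
  moreover have "\<exists>a\<in>C. N a j \<and> r \<in> segment a j" if "j \<in> C - {r}" for j
    using r[of j] that unfolding subtree_def covering_def by auto
  ultimately show thesis using that by blast
qed

lemma card_component_less:
  assumes "finite C" and K: "K \<in> graph_components U (C - {r})" "j \<in> K"
    and a: "a \<in> C" "r \<in> segment a j" "Q a"
  shows "card {x \<in> K. Q x} < card {x \<in> C. Q x}"
proof -
  have "a \<notin> K"
    using a(2) path_convexD[OF component_path_convex[OF K(1)] _ K(2)]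
      component_subset[OF K(1)] by blast
  then have "{x \<in> K. Q x} \<subset> {x \<in> C. Q x}" using a component_subset[OF K(1)] by blast
  then show ?thesis using assms(1) by (intro psubset_card_mono) simp_all
qed

lemma ex_stt_depth_le:
  assumes "finite C" "C \<noteq> {}" "path_convex C" "covers_pairs U C N"
  shows "\<exists>T. is_stt U C T \<and> (\<forall>j\<in>C. depth T j \<le> card {a \<in> C. N a j})"
  using assms
proof (induction C rule: finite_psubset_induct)
  case (psubset C)
  obtain r where r: "r \<in> C" "\<And>j. j \<in> C - {r} \<Longrightarrow> \<exists>a\<in>C. N a j \<and> r \<in> segment a j"
    using dominating_root[OF psubset.hyps(1) psubset.prems] by blast
  let ?comps = "graph_components U (C - {r})"
  have "\<exists>T. is_stt U K T \<and> (\<forall>j\<in>K. depth T j \<le> card {a \<in> K. N a j})" if "K \<in> ?comps" for K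
  proof (rule psubset.IH)
    show "K \<subset> C" using component_subset[OF that] r(1) by blast
    then show "covers_pairs U K N" using covers_pairs_subset psubset.prems(3) by blast
  qed (fact component_nonempty[OF that] component_path_convex[OF that])+
  then obtain f where f: "\<forall>K\<in>?comps. is_stt U K (f K)"
    and depth_f: "\<And>K j. K \<in> ?comps \<Longrightarrow> j \<in> K \<Longrightarrow> depth (f K) j \<le> card {a \<in> K. N a j}"
    by metis
  obtain T where stt: "is_stt U C T" and depth_root: "depth T r = 0"
    and depth_component: "\<And>K j. K \<in> ?comps \<Longrightarrow> j \<in> K \<Longrightarrow> depth T j = Suc (depth (f K) j)"
    using stt_NodeE[OF psubset.hyps(1) r(1) f] by blast
  have "depth T j \<le> card {a \<in> C. N a j}" if "j \<in> C" for j
  proof (cases "j = r")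
    case True
    then show ?thesis by (simp add: depth_root)
  next
    case False
    then obtain K where K: "K \<in> ?comps" "j \<in> K"
      using Union_components[of "C - {r}"] \<open>j \<in> C\<close> by blast
    obtain a where a: "a \<in> C" "N a j" "r \<in> segment a j" using r(2) \<open>j \<in> C\<close> False by blast
    have "depth T j = Suc (depth (f K) j)" by (rule depth_component[OF K])
    also have "\<dots> \<le> Suc (card {a \<in> K. N a j})" using depth_f[OF K] by simp
    also have "\<dots> \<le> card {a \<in> C. N a j}"
      using card_component_less[OF psubset.hyps(1) K a(1,3), of "\<lambda>a. N a j"] a(2) by simp
    finally show ?thesis .
  qed
  then show ?case using stt by blast
qed

end

section \<open>Lower-envelope vertices\<close>

lemma lower_envelope_vertexI:
  assumes "linear d" "P \<in> S" "\<And>i. w $ i \<ge> 0"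
    and unique: "\<And>Q. Q \<in> S \<Longrightarrow> Q \<noteq> P \<Longrightarrow> w \<bullet> d P < w \<bullet> d Q"
  shows "lower_envelope_vertex d S P"
proof -
  have "P \<notin> open_segment a b" if "a \<in> S" "b \<in> S" for a b
  proof
    assume segment: "P \<in> open_segment a b"
    then obtain u where u: "0 < u" "u < 1" and P: "P = (1 - u) *\<^sub>R a + u *\<^sub>R b"
      unfolding in_segment by blast
    have "w \<bullet> d P < w \<bullet> d a" "w \<bullet> d P < w \<bullet> d b"
      using unique that segment by (auto simp: open_segment_def)
    then have "(1 - u) * (w \<bullet> d P) + u * (w \<bullet> d P) < (1 - u) * (w \<bullet> d a) + u * (w \<bullet> d b)"
      using u by (intro add_strict_mono mult_strict_left_mono) auto
    also have "\<dots> = w \<bullet> d P"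
      unfolding P linear_add[OF \<open>linear d\<close>] linear_scale[OF \<open>linear d\<close>]
      by (simp add: inner_add_right)
    finally show False by (simp add: algebra_simps)
  qed
  then have "P extreme_point_of S" using \<open>P \<in> S\<close> unfolding extreme_point_of_def by blast
  moreover have "is_arg_min (\<lambda>q. w \<bullet> d q) (\<lambda>q. q \<in> S) Q \<longleftrightarrow> Q = P" for Q
    using unique \<open>P \<in> S\<close> unfolding is_arg_min_def by (metis order_less_asym)
  ultimately show ?thesis
    unfolding lower_envelope_vertex_def inner_vec_def inner_real_def using assms(3) by blast
qed

lemma lower_envelope_vertex_dominated:
  assumes "lower_envelope_vertex d S P" "Q \<in> S" "\<And>i. d Q $ i \<le> d P $ i"
  shows "Q = P"
proof -
  obtain w where w: "\<And>i. w $ i \<ge> 0"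
    and min: "\<And>Q. is_arg_min (\<lambda>q. \<Sum>i\<in>UNIV. w $ i * d q $ i) (\<lambda>q. q \<in> S) Q \<longleftrightarrow> Q = P"
    using assms(1) unfolding lower_envelope_vertex_def by blast
  have "(\<Sum>i\<in>UNIV. w $ i * d Q $ i) \<le> (\<Sum>i\<in>UNIV. w $ i * d P $ i)"
    using w assms(3) by (intro sum_mono mult_left_mono)
  then have "is_arg_min (\<lambda>q. \<Sum>i\<in>UNIV. w $ i * d q $ i) (\<lambda>q. q \<in> S) Q"
    using min[of P] \<open>Q \<in> S\<close> unfolding is_arg_min_linorder by (meson order_trans)
  then show ?thesis using min by blast
qed

section \<open>Feasible points of the linear program\<close>

locale feasible_point =
  fixes E :: "'v::finite \<Rightarrow> 'v \<Rightarrow> bool" and D :: "real ^ 'v"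
    and X :: "real ^ 'v ^ 'v" and Z :: "real ^ 'v ^ 'v ^ 'v"
  assumes feasible: "(D, X, Z) \<in> stt_polyhedron E"
begin

lemma X_diag: "X $ i $ i = 0"
  using feasible by (simp add: stt_polyhedron_def lp_space_def)

lemma X_nonneg: "X $ i $ j \<ge> 0"
  using feasible X_diag by (cases "i = j") (simp_all add: stt_polyhedron_def)

lemma Z_outside: "k \<notin> between E i j \<Longrightarrow> Z $ k $ i $ j = 0"
  using feasible by (simp add: stt_polyhedron_def lp_space_def)

lemma Z_le_X: "Z $ k $ i $ j \<le> X $ k $ i" "Z $ k $ i $ j \<le> X $ k $ j"
proof -
  have "Z $ k $ i $ j \<le> X $ k $ i \<and> Z $ k $ i $ j \<le> X $ k $ j"
  proof (cases "k \<in> between E i j")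
    case True
    then have "i \<noteq> j" by auto
    then show ?thesis using feasible True by (simp add: stt_polyhedron_def)
  qed (simp add: Z_outside X_nonneg)
  then show "Z $ k $ i $ j \<le> X $ k $ i" "Z $ k $ i $ j \<le> X $ k $ j" by simp_all
qed

lemma pair_constraint:
  "i \<noteq> j \<Longrightarrow> 1 \<le> X $ i $ j + X $ j $ i + (\<Sum>k\<in>between E i j. Z $ k $ i $ j)"
  using feasible by (simp add: stt_polyhedron_def)

lemma column_sum_le: "(\<Sum>j\<in>UNIV. X $ j $ i) \<le> D $ i"
proof -
  have "(\<Sum>j\<in>UNIV. X $ j $ i) = (\<Sum>j\<in>UNIV - {i}. X $ j $ i)"
    by (simp add: sum_diff1 X_diag)
  also have "\<dots> \<le> D $ i" using feasible by (simp add: stt_polyhedron_def)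
  finally show ?thesis .
qed

lemma relaxed_pair_constraint:
  assumes "i \<noteq> j"
  shows "1 \<le> X $ i $ j + (\<Sum>k\<in>insert j (between E i j). X $ k $ i)"
proof -
  have "(\<Sum>k\<in>between E i j. Z $ k $ i $ j) \<le> (\<Sum>k\<in>between E i j. X $ k $ i)"
    by (intro sum_mono Z_le_X)
  moreover have "j \<notin> between E i j" by (simp add: between_def)
  ultimately show ?thesis using pair_constraint[OF assms] by simp
qed

lemma integer_point_covers_pairs:
  assumes "integer_point (D, X, Z)"
  shows "covers_pairs E UNIV (\<lambda>i j. 1 \<le> X $ i $ j)"
  unfolding covers_pairs_def
proof (intro ballI impI)
  have one_le: "1 \<le> x" if "x \<in> \<int>" "0 < x" for x :: real
    using Ints_nonzero_abs_ge1[of x] that by simp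
  have one_le_X: "1 \<le> X $ i $ j" if "0 < X $ i $ j" for i j
    using assms that by (intro one_le) (simp_all add: integer_point_def)
  fix i j :: 'v assume "i \<noteq> j"
  then consider "0 < X $ i $ j" | "0 < X $ j $ i" | "0 < (\<Sum>k\<in>between E i j. Z $ k $ i $ j)"
    using pair_constraint by fastforce
  then show "1 \<le> X $ i $ j \<or> 1 \<le> X $ j $ i \<or> (\<exists>k\<in>between E i j. 1 \<le> X $ k $ i \<and> 1 \<le> X $ k $ j)"
  proof cases
    case 3
    then obtain k where k: "k \<in> between E i j" "0 < Z $ k $ i $ j"
      by (meson not_less sum_nonpos)
    then have "0 < X $ k $ i" "0 < X $ k $ j" using Z_le_X[of k i j] by linarith+
    then show ?thesis using k(1) one_le_X by blast
  qed (use one_le_X in blast)+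
qed

lemma card_X_ge_1_le: "real (card {a. 1 \<le> X $ a $ j}) \<le> D $ j"
proof -
  have "real (card {a. 1 \<le> X $ a $ j}) = (\<Sum>a\<in>UNIV. of_bool (1 \<le> X $ a $ j))" by simp
  also have "\<dots> \<le> (\<Sum>a\<in>UNIV. X $ a $ j)" by (intro sum_mono) (simp add: of_bool_def X_nonneg)
  also have "\<dots> \<le> D $ j" by (rule column_sum_le)
  finally show ?thesis .
qed

end

section \<open>The point of a search tree\<close>

lemma wf_dominating_weights:
  fixes R :: "('a \<times> 'a) set"
  assumes "wf R"
  obtains w :: "'a \<Rightarrow> real" where "\<And>a. 0 < w a" "\<And>a. (\<Sum>i | (i, a) \<in> R. w i) < w a"
proof -
  define w :: "'a \<Rightarrow> real" where "w = wfrec R (\<lambda>w a. 1 + (\<Sum>i | (i, a) \<in> R. w i))"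
  have w: "w a = 1 + (\<Sum>i | (i, a) \<in> R. w i)" for a
    unfolding w_def by (subst wfrec[OF assms]) (simp add: cut_apply)
  have "0 < w a" for a
    using assms
  proof (induction a rule: wf_induct_rule)
    case (less a)
    have "0 \<le> (\<Sum>i | (i, a) \<in> R. w i)" using less by (intro sum_nonneg) (simp add: less_imp_le)
    then show ?case by (subst w) simp
  qed
  moreover have "(\<Sum>i | (i, a) \<in> R. w i) < w a" for a using w[of a] by simp
  ultimately show thesis by (rule that)
qed

definition stt_point :: "('v \<Rightarrow> 'v \<Rightarrow> bool) \<Rightarrow> 'v rtree \<Rightarrow> 'v::finite lp_point" where
  "stt_point E T =
    (\<chi> i. real (depth T i),
     \<chi> i j. of_bool (proper_ancestor T i j),
     \<chi> k i j. of_bool (k \<in> between E i j \<and> proper_ancestor T k i \<and> proper_ancestor T k j))"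

lemma fst_stt_point: "fst (stt_point E T) $ i = real (depth T i)"
  by (simp add: stt_point_def)

locale search_tree = tree_topology U for U :: "'v::finite \<Rightarrow> 'v \<Rightarrow> bool" +
  fixes T :: "'v rtree"
  assumes stt: "is_stt U UNIV T"
begin

abbreviation anc :: "'v \<Rightarrow> 'v \<Rightarrow> bool" where
  "anc \<equiv> proper_ancestor T"

lemmas anc_irrefl = proper_ancestor_irrefl[OF stt]
lemmas anc_trans = proper_ancestor_trans[OF stt]
lemmas anc_between = proper_ancestor_between[OF stt path_convex_UNIV]

lemma anc_asym: "anc i j \<Longrightarrow> \<not> anc j i"
  using anc_trans anc_irrefl by blast

lemma separated_not_anc: "k \<in> between U i j \<Longrightarrow> anc k i \<Longrightarrow> \<not> anc i j"
  using anc_between anc_asym by blast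

lemma common_ancestor_between:
  assumes a: "ancestor_eq T a i" "ancestor_eq T a j" and k: "k \<in> between U i j"
  shows "ancestor_eq T a k"
proof (cases "a = k")
  case True
  then show ?thesis by (simp add: ancestor_eq_def nodes_is_stt[OF stt])
next
  case False
  have "k \<in> segment a i \<or> k \<in> segment a j"
    using k segment_triangle[of i j a] segment_sym[of i a] unfolding between_eq_segment by blast
  then have "k \<in> between U a i \<or> k \<in> between U a j"
    using k False unfolding between_eq_segment by blast
  moreover have "anc a i" if "k \<in> between U a i"
    using a(1) that by (auto simp: ancestor_eq_def)
  moreover have "anc a j" if "k \<in> between U a j"
    using a(2) that by (auto simp: ancestor_eq_def)
  ultimately show ?thesis using anc_between unfolding ancestor_eq_def by blast
qed

lemma is_lca_iff:
  assumes k: "k \<in> between U i j"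
  shows "is_lca T k i j \<longleftrightarrow> anc k i \<and> anc k j"
proof
  assume "is_lca T k i j"
  then show "anc k i \<and> anc k j"
    using k unfolding is_lca_def ancestor_eq_def between_def by blast
next
  assume "anc k i \<and> anc k j"
  then show "is_lca T k i j"
    using common_ancestor_between k unfolding is_lca_def ancestor_eq_def by metis
qed

lemma separating_ancestor_unique:
  assumes "k \<in> between U i j" "anc k i" "anc k j" and "m \<in> between U i j" "anc m i" "anc m j"
  shows "k = m"
proof -
  have "ancestor_eq T k m" "ancestor_eq T m k"
    using assms common_ancestor_between unfolding ancestor_eq_def by metis+
  then show ?thesis using anc_asym unfolding ancestor_eq_def by blast
qed

lemma pair_constraint_tight:
  assumes "i \<noteq> j"
  shows "of_bool (anc i j) + of_bool (anc j i) +
    (\<Sum>k\<in>between U i j. of_bool (anc k i \<and> anc k j)) = (1 :: real)"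
proof -
  let ?K = "between U i j \<inter> {k. anc k i \<and> anc k j}"
  have not_anc: "?K = {}" if "anc i j \<or> anc j i"
    using that separated_not_anc[of _ i j] separated_not_anc[of _ j i] between_sym[of i j] by blast
  have "anc i j \<or> anc j i \<or> (\<exists>k. k \<in> ?K)"
    using proper_ancestor_covers_pairs[OF stt path_convex_UNIV] assms
    unfolding covers_pairs_def by blast
  then consider "anc i j" | "anc j i" | k where "k \<in> ?K" by blast
  then have "of_bool (anc i j) + of_bool (anc j i) + real (card ?K) = 1"
  proof cases
    case 3
    then have "?K = {k}" using separating_ancestor_unique by blast
    moreover have "\<not> anc i j" "\<not> anc j i" using not_anc 3 by blast+
    ultimately show ?thesis by simp
  qed (use not_anc anc_asym in auto)
  then show ?thesis by simp
qed

lemma stt_point_in_lp_space: "stt_point U T \<in> lp_space U"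
  using anc_irrefl between_sym by (auto simp: stt_point_def lp_space_def)

lemma depth_eq_sum: "real (depth T i) = (\<Sum>a\<in>UNIV. of_bool (anc a i))"
  by (simp add: depth_def)

lemma depth_eq_sum_other: "real (depth T i) = (\<Sum>a\<in>UNIV - {i}. of_bool (anc a i))"
proof -
  have "(UNIV - {i}) \<inter> {j. anc j i} = {a. anc a i}" using anc_irrefl by blast
  then show ?thesis by (simp add: depth_def)
qed

lemma induced_by_iff: "induced_by U T P \<longleftrightarrow> P = stt_point U T"
proof
  assume "P = stt_point U T"
  then show "induced_by U T P"
    using stt_point_in_lp_space depth_eq_sum_other is_lca_iff
    by (auto simp: induced_by_def stt_point_def of_bool_def)
next
  obtain D X Z where P: "P = (D, X, Z)" by (cases P)
  assume induced: "induced_by U T P"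
  then have space: "(D, X, Z) \<in> lp_space U" unfolding induced_by_def P by simp
  have X: "X $ i $ j = of_bool (anc i j)" for i j
    using induced space anc_irrefl unfolding induced_by_def lp_space_def P by (cases "i = j") auto
  moreover have "Z $ k $ i $ j = of_bool (k \<in> between U i j \<and> anc k i \<and> anc k j)" for k i j
  proof (cases "k \<in> between U i j")
    case True
    then have "i \<noteq> j" by auto
    then show ?thesis using induced True is_lca_iff[OF True] unfolding induced_by_def P by auto
  qed (use space in \<open>simp add: lp_space_def\<close>)
  moreover have "D $ i = real (depth T i)" for i
  proof -
    have "D $ i = (\<Sum>j\<in>UNIV - {i}. X $ j $ i)" using induced unfolding induced_by_def P by blast
    then show ?thesis unfolding X depth_eq_sum_other .
  qed
  ultimately show "P = stt_point U T"
    unfolding P stt_point_def by (simp add: vec_eq_iff)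
qed

lemma stt_point_feasible: "stt_point U T \<in> stt_polyhedron U"
proof -
  have "1 \<le> of_bool (anc i j) + of_bool (anc j i) +
    (\<Sum>k\<in>between U i j. of_bool (k \<in> between U i j \<and> anc k i \<and> anc k j) :: real)" if "i \<noteq> j" for i j
    using pair_constraint_tight[OF that] by (simp cong: sum.cong)
  then show ?thesis
    using stt_point_in_lp_space depth_eq_sum_other
    unfolding stt_polyhedron_def stt_point_def by simp
qed

definition inversion :: "real ^ 'v ^ 'v \<Rightarrow> 'v \<Rightarrow> real" where
  "inversion X a = (\<Sum>d | anc a d. X $ d $ a)"

context
  fixes D X Z
  assumes feasible: "(D, X, Z) \<in> stt_polyhedron U"
begin

interpretation feasible_point U D X Z
  by unfold_locales (rule feasible)

lemma inversion_nonneg: "0 \<le> inversion X a"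
  unfolding inversion_def by (intro sum_nonneg X_nonneg)

lemma X_ancestor_ge:
  assumes "anc a i"
  shows "1 - inversion X a \<le> X $ a $ i"
proof -
  have "insert i (between U a i) \<subseteq> {d. anc a d}" using assms anc_between by blast
  then have "(\<Sum>k\<in>insert i (between U a i). X $ k $ a) \<le> inversion X a"
    unfolding inversion_def by (intro sum_mono2) (auto simp: X_nonneg)
  moreover have "a \<noteq> i" using assms anc_irrefl by blast
  ultimately show ?thesis using relaxed_pair_constraint[of a i] by linarith
qed

lemma depth_plus_inversion_le:
  "real (depth T i) + inversion X i \<le> D $ i + (\<Sum>a | anc a i. inversion X a)"
proof -
  have "real (depth T i) = (\<Sum>a | anc a i. 1)" by (simp add: depth_def)
  also have "\<dots> \<le> (\<Sum>a | anc a i. X $ a $ i + inversion X a)"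
    using X_ancestor_ge by (intro sum_mono) (simp add: algebra_simps)
  finally have "real (depth T i) \<le> (\<Sum>a | anc a i. X $ a $ i) + (\<Sum>a | anc a i. inversion X a)"
    by (simp add: sum.distrib)
  moreover have "(\<Sum>a | anc a i. X $ a $ i) + inversion X i \<le> D $ i"
  proof -
    have "(\<Sum>a | anc a i. X $ a $ i) + inversion X i = (\<Sum>j\<in>{a. anc a i} \<union> {d. anc i d}. X $ j $ i)"
      unfolding inversion_def using anc_asym by (intro sum.union_disjoint[symmetric]) auto
    also have "\<dots> \<le> (\<Sum>j\<in>UNIV. X $ j $ i)" by (intro sum_mono2) (auto simp: X_nonneg)
    finally show ?thesis using column_sum_le[of i] by linarith
  qed
  ultimately show ?thesis by linarith
qed

lemma weighted_depth_le:
  assumes "\<And>i. 0 \<le> w i"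
  shows "(\<Sum>i\<in>UNIV. w i * real (depth T i)) + (\<Sum>a\<in>UNIV. inversion X a * (w a - (\<Sum>i | anc a i. w i)))
    \<le> (\<Sum>i\<in>UNIV. w i * D $ i)"
proof -
  have "(\<Sum>i\<in>UNIV. w i * (real (depth T i) + inversion X i))
    \<le> (\<Sum>i\<in>UNIV. w i * (D $ i + (\<Sum>a | anc a i. inversion X a)))"
    using assms depth_plus_inversion_le by (intro sum_mono mult_left_mono)
  moreover have "(\<Sum>i\<in>UNIV. w i * (\<Sum>a | anc a i. inversion X a))
    = (\<Sum>a\<in>UNIV. inversion X a * (\<Sum>i | anc a i. w i))"
    using sum.swap_restrict[of UNIV UNIV "\<lambda>i a. w i * inversion X a" "\<lambda>i a. anc a i"]
    by (simp add: sum_distrib_left mult.commute)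
  ultimately show ?thesis
    by (simp add: algebra_simps sum.distrib sum_subtractf)
qed

lemma no_inversion_X:
  assumes "\<And>a. inversion X a = 0" "\<And>i. D $ i = real (depth T i)"
  shows "X $ a $ i = of_bool (anc a i)"
proof -
  have le: "of_bool (anc a i) \<le> X $ a $ i" for a
    using X_ancestor_ge[of a i] assms(1) X_nonneg by simp
  have "(\<Sum>a\<in>UNIV. X $ a $ i) \<le> (\<Sum>a\<in>UNIV. of_bool (anc a i))"
    using column_sum_le[of i] unfolding assms(2) depth_eq_sum .
  then have "(\<Sum>a\<in>UNIV. of_bool (anc a i)) = (\<Sum>a\<in>UNIV. X $ a $ i)"
    by (rule antisym[OF sum_mono[OF le]])
  from sum_mono_inv[OF this le] show ?thesis by simp
qed

lemma X_determines_Z: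
  assumes X: "\<And>i j. X $ i $ j = of_bool (anc i j)"
  shows "Z $ k $ i $ j = of_bool (k \<in> between U i j \<and> anc k i \<and> anc k j)"
proof (cases "k \<in> between U i j")
  case True
  then have "i \<noteq> j" by auto
  have le: "Z $ m $ i $ j \<le> of_bool (anc m i \<and> anc m j)" for m
    using Z_le_X[of m i j] unfolding X by auto
  have "(\<Sum>m\<in>between U i j. Z $ m $ i $ j) = (\<Sum>m\<in>between U i j. of_bool (anc m i \<and> anc m j))"
  proof (rule antisym)
    show "(\<Sum>m\<in>between U i j. of_bool (anc m i \<and> anc m j)) \<le> (\<Sum>m\<in>between U i j. Z $ m $ i $ j)"
      using pair_constraint[OF \<open>i \<noteq> j\<close>] pair_constraint_tight[OF \<open>i \<noteq> j\<close>] unfolding X by linarith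
  qed (intro sum_mono le)
  then have "Z $ k $ i $ j = of_bool (anc k i \<and> anc k j)"
    using le True by (rule sum_mono_inv) auto
  then show ?thesis using True by simp
qed (simp add: Z_outside)

context
  fixes w :: "'v \<Rightarrow> real"
  assumes pos: "\<And>i. 0 < w i"
    and dominating: "\<And>a. (\<Sum>i | anc a i. w i) < w a"
    and optimal: "(\<Sum>i\<in>UNIV. w i * D $ i) \<le> (\<Sum>i\<in>UNIV. w i * real (depth T i))"
begin

lemma optimal_imp_no_inversion: "inversion X a = 0"
proof -
  let ?gap = "\<lambda>a. inversion X a * (w a - (\<Sum>i | anc a i. w i))"
  have gap_nonneg: "0 \<le> ?gap a" for a
    using inversion_nonneg dominating[of a] by simp
  have "(\<Sum>a\<in>UNIV. ?gap a) \<le> 0"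
    using weighted_depth_le[of w] pos optimal by (simp add: less_imp_le)
  then have "(\<Sum>a\<in>UNIV. ?gap a) = 0" using gap_nonneg by (intro antisym sum_nonneg)
  then have "?gap a = 0" using gap_nonneg by (simp add: sum_nonneg_eq_0_iff)
  then show ?thesis
    using dominating[of a] by (metis diff_gt_0_iff_gt less_irrefl mult_eq_0_iff)
qed

lemma optimal_imp_D_eq_depth: "D $ i = real (depth T i)"
proof -
  have "depth T i \<le> D $ i" for i
    using depth_plus_inversion_le[of i] optimal_imp_no_inversion by simp
  then have le: "w i * real (depth T i) \<le> w i * D $ i" for i using pos[of i] by simp
  then have "(\<Sum>i\<in>UNIV. w i * real (depth T i)) = (\<Sum>i\<in>UNIV. w i * D $ i)"
    by (rule antisym[OF sum_mono optimal])
  then have "w i * real (depth T i) = w i * D $ i"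
    using le by (rule sum_mono_inv) simp_all
  then show ?thesis using pos[of i] by simp
qed

lemma optimal_imp_stt_point: "(D, X, Z) = stt_point U T"
proof -
  note X = no_inversion_X[OF optimal_imp_no_inversion optimal_imp_D_eq_depth]
  show ?thesis
    unfolding stt_point_def
    by (simp add: vec_eq_iff optimal_imp_D_eq_depth X X_determines_Z[OF X])
qed

end

end

lemma dominating_weights:
  obtains w where "\<And>i. 0 < w i" "\<And>a. (\<Sum>i | anc a i. w i) < (w a :: real)"
proof -
  have "trans {(i, a). anc a i}" using anc_trans by (auto intro: transI)
  then have "acyclic {(i, a). anc a i}" using anc_irrefl by (simp add: acyclic_def)
  then have "wf {(i, a). anc a i}" by (intro finite_acyclic_wf) auto
  then obtain w :: "'v \<Rightarrow> real" where "\<And>a. 0 < w a"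
    "\<And>a. (\<Sum>i | (i, a) \<in> {(i, a). anc a i}. w i) < w a"
    using wf_dominating_weights by blast
  then show thesis using that[of w] by simp
qed

lemma stt_point_lower_envelope_vertex:
  "lower_envelope_vertex fst (stt_polyhedron U) (stt_point U T)"
proof -
  obtain w where w: "\<And>i. 0 < w i" "\<And>a. (\<Sum>i | anc a i. w i) < (w a :: real)"
    by (rule dominating_weights) blast
  show ?thesis
  proof (rule lower_envelope_vertexI[where w = "\<chi> i. w i"])
    show "(\<chi> i. w i) $ i \<ge> 0" for i using w(1)[of i] by simp
    fix Q assume Q: "Q \<in> stt_polyhedron U" "Q \<noteq> stt_point U T"
    obtain D X Z where DXZ: "Q = (D, X, Z)" by (cases Q)
    have "(\<Sum>i\<in>UNIV. w i * real (depth T i)) < (\<Sum>i\<in>UNIV. w i * D $ i)"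
      using optimal_imp_stt_point[of D X Z, OF _ w] Q unfolding DXZ by force
    then show "(\<chi> i. w i) \<bullet> fst (stt_point U T) < (\<chi> i. w i) \<bullet> fst Q"
      by (simp add: DXZ inner_vec_def fst_stt_point)
  qed (simp_all add: linear_fst stt_point_feasible)
qed

end

lemma integer_point_dominated_by_stt:
  assumes "is_tree U" "P \<in> stt_polyhedron U" "integer_point P"
  obtains T where "is_stt U UNIV T" "\<And>i. fst (stt_point U T) $ i \<le> fst P $ i"
proof -
  obtain D X Z where P: "P = (D, X, Z)" by (cases P)
  interpret tree_topology U by unfold_locales (rule assms(1))
  interpret feasible_point U D X Z using assms(2) unfolding P by unfold_locales
  have "covers_pairs U UNIV (\<lambda>i j. 1 \<le> X $ i $ j)"
    using integer_point_covers_pairs assms(3) unfolding P .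
  then obtain T where "is_stt U UNIV T" "\<And>j. depth T j \<le> card {a. 1 \<le> X $ a $ j}"
    using ex_stt_depth_le[OF finite _ path_convex_UNIV] by auto
  moreover have "real (depth T j) \<le> D $ j" if "depth T j \<le> card {a. 1 \<le> X $ a $ j}" for T j
    using that card_X_ge_1_le[of j] by linarith
  ultimately show thesis using that unfolding P fst_stt_point by simp
qed

theorem theorem3p6:
  fixes U :: "'v::finite \<Rightarrow> 'v \<Rightarrow> bool" and P :: "'v lp_point"
  assumes "is_tree U"
    and "P \<in> stt_polyhedron U"
    and "integer_point P"
  shows "((\<exists>T. is_stt U UNIV T \<and> induced_by U T P) \<longrightarrow>
            lower_envelope_vertex fst (stt_polyhedron U) P) \<and>
         (lower_envelope_vertex id (fst ` stt_polyhedron U) (fst P) \<longrightarrow>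
            (\<exists>T. is_stt U UNIV T \<and> induced_by U T P))"
proof (intro conjI impI)
  assume "\<exists>T. is_stt U UNIV T \<and> induced_by U T P"
  then obtain T where T: "is_stt U UNIV T" "induced_by U T P" by blast
  interpret search_tree U T using assms(1) T(1) by unfold_locales
  show "lower_envelope_vertex fst (stt_polyhedron U) P"
    using stt_point_lower_envelope_vertex T(2) induced_by_iff by simp
next
  assume vertex: "lower_envelope_vertex id (fst ` stt_polyhedron U) (fst P)"
  obtain T where T: "is_stt U UNIV T" and dominated: "\<And>i. fst (stt_point U T) $ i \<le> fst P $ i"
    using integer_point_dominated_by_stt[OF assms] by blast
  interpret search_tree U T using assms(1) T by unfold_locales
  have "fst (stt_point U T) = fst P"
    using lower_envelope_vertex_dominated[OF vertex] stt_point_feasible dominated by simp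
  then have "P = stt_point U T"
    using lower_envelope_vertex_dominated[OF stt_point_lower_envelope_vertex assms(2)] by simp
  then show "\<exists>T. is_stt U UNIV T \<and> induced_by U T P" using T induced_by_iff by blast
qed

end
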